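(* Let $F$ be a complex $\ell\times\ell$ matrix with $W(F)\subset\operatorname{UHP}$. Then: (i) $W(F^\lambda)\subset\operatorname{sgn}(\lambda)\operatorname{UHP}$ for all $\lambda\in[-1,1]\setminus\{0\}$; (ii) $\|F^{i\lambda}\|<1$ for all real $\lambda>0$; (iii) $\operatorname{sgn}(\lambda)\,\bigl(\operatorname{Id}_\ell-F^{i\lambda}(F^{i\lambda})^*\bigr)>0$ for all $\lambda\in\mathbb{R}\setminus\{0\}$.
   Context: $\operatorname{UHP}=\{z\in\mathbb{C}:\operatorname{Im}z>0\}$, and $-\operatorname{UHP}=\{-z: z\in\operatorname{UHP}\}$. $W(F)=\{\langle Fx,x\rangle: x\in\mathbb{C}^\ell,\ \|x\|=1\}$ is the numerical range for the standard Hermitian inner product; it contains the spectrum $\sigma(F)$. $\|\cdot\|$ is the operator norm induced by the Euclidean norm, $^*$ the conjugate transpose, $\operatorname{Id}_\ell$ the identity matrix, and $B>0$ means that $B$ is Hermitian positive definite. For $\mu\in\mathbb{C}$, $F^\mu$ is defined by the holomorphic functional calculus applied to $z^\mu=\exp(\mu\log z)$, where $\log z=\log|z|+i\arg z$ is the principal branch with $\arg z\in(-\pi,\pi]$. *)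

theory Defs
  imports "HOL-Complex_Analysis.Complex_Analysis"
begin

definition UHP :: "complex set" where
  "UHP = {z. Im z > 0}"

text \<open>The library inner product on \<^typ>\<open>complex ^ 'n\<close> is the real-valued one, so the
  Hermitian one (linear in the first argument) is introduced here. The library norm on
  \<^typ>\<open>complex ^ 'n\<close> is the Euclidean norm belonging to it.\<close>

definition herm_inner :: "complex ^ 'n \<Rightarrow> complex ^ 'n \<Rightarrow> complex" where
  "herm_inner x y = (\<Sum>i\<in>UNIV. x $ i * cnj (y $ i))"

definition numerical_range :: "complex ^ 'n ^ 'n \<Rightarrow> complex set" where
  "numerical_range F = {herm_inner (F *v x) x | x. norm x = 1}"

definition conj_transpose :: "complex ^ 'n ^ 'm \<Rightarrow> complex ^ 'm ^ 'n" where
  "conj_transpose A = (\<chi> i j. cnj (A $ j $ i))"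

definition pos_definite :: "complex ^ 'n ^ 'n \<Rightarrow> bool" where
  "pos_definite B \<longleftrightarrow>
     conj_transpose B = B \<and> (\<forall>x. x \<noteq> 0 \<longrightarrow> Re (herm_inner (B *v x) x) > 0)"

definition mat_spectrum :: "complex ^ 'n ^ 'n \<Rightarrow> complex set" where
  "mat_spectrum F = {z. \<not> invertible (mat z - F)}"

text \<open>Contours for the Riesz--Dunford integral. As the domain \<open>U\<close> is taken connected and the
  spectrum is finite, a single closed path is enough; no formal sums of paths are needed.\<close>

definition fc_contour ::
    "(complex \<Rightarrow> complex) \<Rightarrow> complex ^ 'n ^ 'n \<Rightarrow> (real \<Rightarrow> complex) \<Rightarrow> bool" where
  "fc_contour f F \<gamma> \<longleftrightarrow>
     (\<exists>U. open U \<and> connected U \<and> mat_spectrum F \<subseteq> U \<and> f holomorphic_on U \<and>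
          valid_path \<gamma> \<and> pathfinish \<gamma> = pathstart \<gamma> \<and> path_image \<gamma> \<subseteq> U - mat_spectrum F \<and>
          (\<forall>z\<in>mat_spectrum F. winding_number \<gamma> z = 1) \<and>
          (\<forall>z. z \<notin> U \<longrightarrow> winding_number \<gamma> z = 0))"

definition fc_integral ::
    "(complex \<Rightarrow> complex) \<Rightarrow> complex ^ 'n ^ 'n \<Rightarrow> (real \<Rightarrow> complex) \<Rightarrow> complex ^ 'n ^ 'n" where
  "fc_integral f F \<gamma> =
     (\<chi> i j. 1 / (2 * of_real pi * \<i>) *
        contour_integral \<gamma> (\<lambda>z. f z * matrix_inv (mat z - F) $ i $ j))"

text \<open>Holomorphic functional calculus \<open>f(F) = 1 / (2 \<pi> \<i>) \<integral> f(z) (z Id - F)\<^sup>-\<^sup>1 dz\<close>. By the residue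
  theorem all contours satisfying \<open>fc_contour f F\<close> (also for different domains \<open>U\<close>) give the same
  value, so the choice is harmless. If \<open>f\<close> is not holomorphic on a connected open
  neighbourhood of the spectrum, the value is unspecified.\<close>

definition holo_calc ::
    "(complex \<Rightarrow> complex) \<Rightarrow> complex ^ 'n ^ 'n \<Rightarrow> complex ^ 'n ^ 'n" where
  "holo_calc f F = fc_integral f F (SOME \<gamma>. fc_contour f F \<gamma>)"

text \<open>\<^const>\<open>Ln\<close> is the principal branch, with imaginary part in \<open>(-\<pi>, \<pi>]\<close>.\<close>

definition mat_powr :: "complex ^ 'n ^ 'n \<Rightarrow> complex \<Rightarrow> complex ^ 'n ^ 'n" where
  "mat_powr F \<mu> = holo_calc (\<lambda>z. exp (\<mu> * Ln z)) F"

end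

theory Submission
  imports Defs
begin

text \<open>Let \<open>\<delta> > 0\<close> be the least imaginary part in the compact set \<open>W(F)\<close>. Expanding
  \<open>\<parallel>F x - \<i> R x\<parallel>\<^sup>2\<close> shows that for large \<open>R\<close> there is \<open>\<rho> < R\<close> with \<open>\<parallel>F - \<i> R\<parallel> \<le> \<rho>\<close>
  (\<open>numerical_range_UHP_disc_bounded\<close>). The disc around \<open>c = \<i> R\<close> of radius \<open>R\<close> lies in the upper half
  plane, where the powers \<open>z\<^sup>\<mu>\<close> are holomorphic. Hence \<open>F\<^sup>\<mu>\<close> can be computed with a circle around \<open>c\<close> of
  radius \<open>r\<close> between \<open>\<rho>\<close> and \<open>R\<close>; by the residue theorem the choice of the contour does not matter
  (\<open>holo_calc_eq_fc_integral\<close>).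

  On this circle let \<open>P(z)\<close> be the sum of \<open>(z - c) (z - F)\<^sup>-\<^sup>1\<close> and its adjoint, minus the identity. It is
  positive because \<open>\<parallel>F - c\<parallel> < r\<close>, and \<open>f(F)\<close> is the mean of \<open>f(z) P(z)\<close> over the circle: the adjoint
  term is an antiholomorphic function of \<open>z\<close> outside the disc, so on the circle it coincides with a
  function holomorphic inside, whose contribution cancels that of the identity
  (\<open>mean_poisson_form\<close>, \<open>poisson_form_nonneg\<close>). Two consequences for the calculus follow:
  half planes that contain the values of \<open>f\<close> on the circle contain \<open>W(f(F))\<close>
  (\<open>fc_integral_half_plane\<close>), and \<open>\<parallel>f(F)\<parallel>\<close> is bounded by the maximum of \<open>|f|\<close> on the circle
  (\<open>fc_integral_norm_le\<close>).

  The rest is about scalars. For \<open>Im z > 0\<close> one has \<open>0 < arg z < \<pi>\<close>. So \<open>Im z\<^sup>\<lambda>\<close> has the sign of \<open>\<lambda>\<close> when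
  \<open>0 < |\<lambda>| \<le> 1\<close>, and \<open>|z\<^bsup>\<i>\<lambda>\<^esup>| = exp (- \<lambda> arg z) < 1\<close> when \<open>\<lambda> > 0\<close>; compactness of the circle makes both
  statements uniform. This proves (i) and (ii), and (iii) for \<open>\<lambda> > 0\<close>, since the adjoint of a strict
  contraction is one. For \<open>\<lambda> < 0\<close> the calculus is multiplicative (\<open>fc_integral_mult\<close>), so \<open>F\<^bsup>\<i>\<lambda>\<^esup>\<close> is the
  inverse of the strict contraction \<open>F\<^bsup>-\<i>\<lambda>\<^esup>\<close>, and its adjoint strictly increases norms.\<close>

section \<open>The Hermitian inner product\<close>

lemma herm_inner_diff_left: "herm_inner (x - y) z = herm_inner x z - herm_inner y z"
  and herm_inner_diff_right: "herm_inner z (x - y) = herm_inner z x - herm_inner z y"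
  by (simp_all add: herm_inner_def algebra_simps sum_subtractf)

lemma herm_inner_smult_left: "herm_inner (a *s x) y = a * herm_inner x y"
  and herm_inner_smult_right: "herm_inner x (a *s y) = cnj a * herm_inner x y"
  by (simp_all add: herm_inner_def sum_distrib_left algebra_simps)

lemma herm_inner_scaleR_left: "herm_inner (a *\<^sub>R x) y = a * herm_inner x y"
  by (simp add: herm_inner_def sum_distrib_left) (simp add: scaleR_conv_of_real algebra_simps)

lemma cnj_herm_inner: "cnj (herm_inner x y) = herm_inner y x"
  by (simp add: herm_inner_def mult.commute)

lemma herm_inner_self: "herm_inner x x = of_real ((norm x)\<^sup>2)"
  by (simp add: herm_inner_def norm_vec_def L2_set_def sum_nonneg complex_norm_square
      del: of_real_power)

lemma Re_herm_inner_self [simp]: "Re (herm_inner x x) = (norm x)\<^sup>2"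
  by (simp add: herm_inner_self)

lemma Re_herm_inner: "Re (herm_inner x y) = x \<bullet> y"
  by (simp add: herm_inner_def inner_vec_def inner_complex_def)

lemma norm_smult_complex_vec: "norm (a *s (x :: complex ^ 'n)) = norm a * norm x"
  by (simp add: norm_vec_def L2_set_def norm_mult power_mult_distrib real_sqrt_mult
      flip: sum_distrib_left)

lemma herm_inner_matrix:
  "herm_inner (A *v x) y = (\<Sum>i\<in>UNIV. \<Sum>j\<in>UNIV. A $ i $ j * (x $ j * cnj (y $ i)))"
  by (simp add: herm_inner_def matrix_vector_mult_def sum_distrib_right mult.assoc)

lemma herm_inner_conj_transpose: "herm_inner (conj_transpose A *v x) y = herm_inner x (A *v y)"
  unfolding herm_inner_matrix
  by (subst sum.swap)
     (simp add: herm_inner_def matrix_vector_mult_def conj_transpose_def sum_distrib_left algebra_simps)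

lemma conj_transpose_mult: "conj_transpose (A ** B) = conj_transpose B ** conj_transpose A"
  by (simp add: conj_transpose_def matrix_matrix_mult_def vec_eq_iff mult.commute)

lemma conj_transpose_mat_1 [simp]: "conj_transpose (mat 1) = mat 1"
  by (simp add: conj_transpose_def mat_def vec_eq_iff)

lemma conj_transpose_conj_transpose [simp]: "conj_transpose (conj_transpose A) = A"
  by (simp add: conj_transpose_def vec_eq_iff)

lemma herm_inner_matrix_eqI:
  assumes "\<And>x y. herm_inner (A *v x) y = herm_inner (B *v x) y"
  shows "A = B"
proof -
  have "A *v x = B *v x" for x
  proof -
    have "herm_inner (A *v x - B *v x) (A *v x - B *v x) = 0"
      using assms[of x "A *v x - B *v x"] by (simp add: herm_inner_diff_left)
    then show ?thesis
      by (simp add: herm_inner_self)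
  qed
  then show ?thesis
    by (simp add: matrix_eq)
qed

section \<open>The resolvent\<close>

abbreviation resolvent :: "complex ^ 'n ^ 'n \<Rightarrow> complex \<Rightarrow> complex ^ 'n ^ 'n" where
  "resolvent F z \<equiv> matrix_inv (mat z - F)"

lemma mat_mult_vec: "mat z *v x = z *s (x :: complex ^ 'n)"
  by (simp add: mat_def matrix_vector_mult_def vec_eq_iff if_distrib if_distribR cong: if_cong)

lemma mult_matrix_inv:
  assumes "invertible (A :: complex ^ 'n ^ 'n)"
  shows "A ** matrix_inv A = mat 1" "matrix_inv A ** A = mat 1"
  using someI_ex[OF assms[unfolded invertible_def]] by (simp_all add: matrix_inv_def)

lemma invertible_iff_injective:
  "invertible (A :: complex ^ 'n ^ 'n) \<longleftrightarrow> (\<forall>x. A *v x = 0 \<longrightarrow> x = 0)"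
  by (simp add: invertible_left_inverse matrix_left_invertible_ker)

text \<open>By Cramer's rule the entries of the inverse are quotients of polynomials in the entries of the
  matrix, so holomorphic dependence is inherited.\<close>

lemma holomorphic_on_det:
  fixes A :: "complex \<Rightarrow> complex ^ 'n ^ 'n"
  assumes "\<And>i j. (\<lambda>z. A z $ i $ j) holomorphic_on S"
  shows "(\<lambda>z. det (A z)) holomorphic_on S"
  unfolding det_def by (intro holomorphic_intros assms)

lemma holomorphic_on_matrix_inv:
  fixes A :: "complex \<Rightarrow> complex ^ 'n ^ 'n"
  assumes holo: "\<And>i j. (\<lambda>z. A z $ i $ j) holomorphic_on S"
    and inv: "\<And>z. z \<in> S \<Longrightarrow> invertible (A z)"
  shows "(\<lambda>z. matrix_inv (A z) $ i $ j) holomorphic_on S"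
proof -
  let ?C = "\<lambda>z. (\<chi> k l. if l = i then axis j 1 $ k else A z $ k $ l) :: complex ^ 'n ^ 'n"
  have "(\<lambda>z. det (?C z) / det (A z)) holomorphic_on S"
  proof (intro holomorphic_on_divide holomorphic_on_det holo)
    show "(\<lambda>z. ?C z $ k $ l) holomorphic_on S" for k l
      by (cases "l = i") (simp_all add: holo)
    show "\<And>z. z \<in> S \<Longrightarrow> det (A z) \<noteq> 0"
      using inv by (simp add: invertible_det_nz)
  qed
  moreover have "det (?C z) / det (A z) = matrix_inv (A z) $ i $ j" if "z \<in> S" for z
  proof -
    have "A z *v (matrix_inv (A z) *v axis j 1) = axis j 1"
      using mult_matrix_inv[OF inv[OF that]] by (simp add: matrix_vector_mul_assoc)
    then have "matrix_inv (A z) *v axis j 1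
        = (\<chi> i. det (\<chi> k l. if l = i then axis j 1 $ k else A z $ k $ l) / det (A z))"
      using inv[OF that] by (simp add: cramer invertible_det_nz)
    moreover have "(matrix_inv (A z) *v axis j 1) $ i = matrix_inv (A z) $ i $ j"
      by (simp add: matrix_vector_mult_def axis_def if_distrib cong: if_cong)
    ultimately show ?thesis
      by simp
  qed
  ultimately show ?thesis
    by (simp cong: holomorphic_cong)
qed

lemma holomorphic_on_mat_minus: "(\<lambda>z. (mat z - F) $ i $ j) holomorphic_on S"
proof (cases "i = j")
qed (auto simp: mat_def intro!: holomorphic_intros)

lemma holomorphic_on_resolvent: "(\<lambda>z. resolvent F z $ i $ j) holomorphic_on - mat_spectrum F"
  by (rule holomorphic_on_matrix_inv[OF holomorphic_on_mat_minus]) (simp add: mat_spectrum_def)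

lemma holomorphic_on_herm_inner_matrix:
  fixes A :: "complex \<Rightarrow> complex ^ 'n ^ 'n"
  assumes "\<And>i j. (\<lambda>z. A z $ i $ j) holomorphic_on S"
  shows "(\<lambda>z. herm_inner (A z *v x) y) holomorphic_on S"
  unfolding herm_inner_matrix by (intro holomorphic_intros assms)

lemma matrix_mult_resolvent:
  assumes "z \<notin> mat_spectrum F"
  shows "z *s (resolvent F z *v x) - F *v (resolvent F z *v x) = x"
    and "resolvent F z *v (z *s x - F *v x) = x"
proof -
  have inv: "invertible (mat z - F)"
    using assms by (simp add: mat_spectrum_def)
  have *: "z *s v - F *v v = (mat z - F) *v v" for v
    by (simp add: matrix_vector_mult_diff_rdistrib mat_mult_vec)
  show "z *s (resolvent F z *v x) - F *v (resolvent F z *v x) = x"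
    and "resolvent F z *v (z *s x - F *v x) = x"
    unfolding * by (simp_all add: matrix_vector_mul_assoc mult_matrix_inv[OF inv])
qed

lemma resolvent_identity:
  assumes z: "z \<notin> mat_spectrum F" and w: "w \<notin> mat_spectrum F"
  shows "resolvent F z *v x - resolvent F w *v x
           = (w - z) *s (resolvent F z *v (resolvent F w *v x))"
proof -
  define v where "v = resolvent F w *v x"
  have "x = (w - z) *s v + (z *s v - F *v v)"
    using matrix_mult_resolvent(1)[OF w, of x] by (simp add: v_def vector_sub_rdistrib)
  then have "resolvent F z *v x = resolvent F z *v ((w - z) *s v)
      + resolvent F z *v (z *s v - F *v v)"
    by (metis matrix_vector_right_distrib)
  also have "\<dots> = (w - z) *s (resolvent F z *v v) + v"
    by (simp add: matrix_mult_resolvent(2)[OF z] vector_scalar_commute del: vector_sub_rdistrib)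
  finally show ?thesis
    by (simp add: v_def)
qed

section \<open>The contour integral and its independence of the contour\<close>

text \<open>Testing the matrix-valued integral against vectors turns it into scalar contour integrals,
  for which Cauchy's theorem and its relatives are at hand.\<close>

lemma fc_integral_form:
  assumes "open U" "f holomorphic_on U" "valid_path \<gamma>" "path_image \<gamma> \<subseteq> U - mat_spectrum F"
    and fin: "finite (mat_spectrum F)"
  shows "((\<lambda>z. f z * herm_inner (resolvent F z *v x) y) has_contour_integral
            2 * of_real pi * \<i> * herm_inner (fc_integral f F \<gamma> *v x) y) \<gamma>"
proof -
  have "(\<lambda>z. f z * resolvent F z $ i $ j) contour_integrable_on \<gamma>" for i j
  proof (rule contour_integrable_holomorphic_simple)
    show "(\<lambda>z. f z * resolvent F z $ i $ j) holomorphic_on U - mat_spectrum F"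
      by (intro holomorphic_intros holomorphic_on_subset[OF assms(2)]
          holomorphic_on_subset[OF holomorphic_on_resolvent]) auto
    show "open (U - mat_spectrum F)"
      using assms fin by (simp add: open_Diff finite_imp_closed)
  qed (use assms in auto)
  then have "((\<lambda>z. f z * resolvent F z $ i $ j) has_contour_integral
      2 * of_real pi * \<i> * fc_integral f F \<gamma> $ i $ j) \<gamma>" for i j
    by (auto simp: fc_integral_def has_contour_integral_integral)
  then have "((\<lambda>z. \<Sum>i\<in>UNIV. \<Sum>j\<in>UNIV. (f z * resolvent F z $ i $ j) * (x $ j * cnj (y $ i)))
      has_contour_integral
     (\<Sum>i\<in>UNIV. \<Sum>j\<in>UNIV. (2 * of_real pi * \<i> * fc_integral f F \<gamma> $ i $ j) * (x $ j * cnj (y $ i)))) \<gamma>"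
    by (intro has_contour_integral_sum has_contour_integral_rmul) auto
  then show ?thesis
    by (simp add: herm_inner_matrix sum_distrib_left mult.assoc)
qed

text \<open>The right-hand side depends only on the values of \<open>f\<close> near the spectrum, so two contours that live
  in different domains \<open>U\<close> still give the same matrix.\<close>

lemma fc_integral_eq_residues:
  assumes "fc_contour f F \<gamma>" and fin: "finite (mat_spectrum F)"
  shows "fc_integral f F \<gamma> $ i $ j =
           (\<Sum>p\<in>mat_spectrum F. residue (\<lambda>z. f z * resolvent F z $ i $ j) p)"
proof -
  obtain U where U: "open U" "connected U" "f holomorphic_on U"
    "valid_path \<gamma>" "pathfinish \<gamma> = pathstart \<gamma>" "path_image \<gamma> \<subseteq> U - mat_spectrum F"
    "\<And>z. z \<in> mat_spectrum F \<Longrightarrow> winding_number \<gamma> z = 1"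
    "\<And>z. z \<notin> U \<Longrightarrow> winding_number \<gamma> z = 0"
    using assms(1) unfolding fc_contour_def by blast
  have "contour_integral \<gamma> (\<lambda>z. f z * resolvent F z $ i $ j) =
     2 * pi * \<i> * (\<Sum>p\<in>mat_spectrum F. winding_number \<gamma> p * residue (\<lambda>z. f z * resolvent F z $ i $ j) p)"
  proof (rule Residue_theorem)
    show "(\<lambda>z. f z * resolvent F z $ i $ j) holomorphic_on U - mat_spectrum F"
      by (intro holomorphic_intros holomorphic_on_subset[OF U(3)]
          holomorphic_on_subset[OF holomorphic_on_resolvent]) auto
  qed (use U fin in auto)
  then show ?thesis
    using U(7) by (simp add: fc_integral_def)
qed

lemma holo_calc_eq_fc_integral:
  assumes "fc_contour f F \<gamma>" "finite (mat_spectrum F)"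
  shows "holo_calc f F = fc_integral f F \<gamma>"
proof -
  have "fc_contour f F (SOME \<gamma>. fc_contour f F \<gamma>)"
    using assms(1) by (rule someI[where P = "fc_contour f F"])
  then show ?thesis
    using assms by (simp add: holo_calc_def vec_eq_iff fc_integral_eq_residues)
qed

section \<open>Matrices close to a scalar\<close>

text \<open>The hypothesis \<open>\<parallel>F - c\<parallel> \<le> \<rho>\<close> plays the role of a contraction hypothesis in von Neumann's inequality.
  It is stronger than a bound on the spectrum: it makes the Poisson kernel of \<open>F\<close> positive on the
  circles around \<open>c\<close> of radius larger than \<open>\<rho>\<close>.\<close>

locale disc_bounded =
  fixes F :: "complex ^ 'n::finite ^ 'n" and c :: complex and \<rho> :: real
  assumes bound: "norm (F *v x - c *s x) \<le> \<rho> * norm x"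
begin

lemma rho_nonneg: "0 \<le> \<rho>"
proof -
  have "0 \<le> \<rho> * norm (axis undefined 1 :: complex ^ 'n)"
    using bound order_trans norm_ge_zero by blast
  then show ?thesis
    by simp
qed

lemma mat_spectrum_subset: "mat_spectrum F \<subseteq> cball c \<rho>"
proof
  fix z assume "z \<in> mat_spectrum F"
  then obtain x where x: "x \<noteq> 0" "(mat z - F) *v x = 0"
    by (auto simp: mat_spectrum_def invertible_iff_injective)
  then have "F *v x = z *s x"
    by (simp add: matrix_vector_mult_diff_rdistrib mat_mult_vec)
  then have "norm (z - c) * norm x \<le> \<rho> * norm x"
    using bound[of x] by (simp flip: vector_sub_rdistrib norm_smult_complex_vec)
  then show "z \<in> cball c \<rho>"
    using x by (simp add: dist_norm norm_minus_commute)
qed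

lemma not_in_spectrum: "\<rho> < norm (z - c) \<Longrightarrow> z \<notin> mat_spectrum F"
  using mat_spectrum_subset by (auto simp: dist_norm norm_minus_commute)

text \<open>The spectrum is the zero set of the entire function \<open>det (z - F)\<close>. This function does not vanish
  outside the disc, so an infinite zero set inside the disc would contradict the identity theorem.\<close>

lemma finite_mat_spectrum: "finite (mat_spectrum F)"
proof (rule ccontr)
  assume inf: "infinite (mat_spectrum F)"
  let ?d = "\<lambda>z. det (mat z - F)"
  have spec: "mat_spectrum F = {z \<in> cball c \<rho>. ?d z = 0}"
    using mat_spectrum_subset by (auto simp: mat_spectrum_def invertible_det_nz)
  have holo: "?d holomorphic_on UNIV"
    by (intro holomorphic_on_det holomorphic_on_mat_minus)
  have "?d constant_on UNIV"
  proof (rule ccontr)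
    assume "\<not> ?d constant_on UNIV"
    then have "finite {z \<in> cball c \<rho>. ?d z = 0}"
      by (intro holomorphic_compact_finite_zeros[OF holo]) auto
    with inf spec show False
      by simp
  qed
  moreover obtain z where "z \<in> mat_spectrum F"
    using inf by (metis finite.emptyI all_not_in_conv)
  ultimately have "c + of_real (\<rho> + 1) \<in> mat_spectrum F"
    unfolding constant_on_def mat_spectrum_def invertible_det_nz by (metis UNIV_I mem_Collect_eq)
  moreover have "\<rho> < norm (c + of_real (\<rho> + 1) - c)"
    using rho_nonneg by (simp del: of_real_add)
  ultimately show False
    using not_in_spectrum by blast
qed

lemma fc_contour_circlepath:
  assumes "open U" "connected U" "f holomorphic_on U" "cball c r \<subseteq> U" "\<rho> < r"
  shows "fc_contour f F (circlepath c r)"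
  unfolding fc_contour_def
proof (intro exI[of _ U] conjI ballI allI impI)
  show "mat_spectrum F \<subseteq> U"
    using mat_spectrum_subset assms by force
  show "path_image (circlepath c r) \<subseteq> U - mat_spectrum F"
  proof
    fix z assume "z \<in> path_image (circlepath c r)"
    then have "norm (z - c) = r"
      using rho_nonneg assms by (simp add: dist_norm norm_minus_commute)
    then show "z \<in> U - mat_spectrum F"
      using not_in_spectrum[of z] assms by (auto simp: dist_norm norm_minus_commute subset_iff)
  qed
  show "winding_number (circlepath c r) z = 1" if "z \<in> mat_spectrum F" for z
  proof (rule winding_number_circlepath)
    show "norm (z - c) < r"
      using that mat_spectrum_subset assms by (force simp: dist_norm norm_minus_commute)
  qed
  show "winding_number (circlepath c r) z = 0" if "z \<notin> U" for z
    using that assms rho_nonneg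
    by (intro winding_number_zero_outside[of _ "cball c r"]) auto
qed (use assms in auto)

end

section \<open>Circle means\<close>

text \<open>On a circle around \<open>c\<close> the form \<open>dz / (2 \<pi> \<i> (z - c))\<close> is the normalised arc length. Means over the
  parameter interval, unlike contour integrals, respect conjugation and order.\<close>

lemma has_contour_integral_circlepath_iff_mean:
  assumes "0 < r"
  shows "((\<lambda>z. \<phi> z / (z - c)) has_contour_integral 2 * of_real pi * \<i> * m) (circlepath c r) \<longleftrightarrow>
         ((\<lambda>t. \<phi> (circlepath c r t)) has_integral m) {0..1}"
proof -
  have "\<phi> (circlepath c r t) / (circlepath c r t - c)
           * vector_derivative (circlepath c r) (at t) = 2 * of_real pi * \<i> * \<phi> (circlepath c r t)" for t
    unfolding vector_derivative_circlepath using assms by (simp add: circlepath)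
  then have "((\<lambda>z. \<phi> z / (z - c)) has_contour_integral 2 * of_real pi * \<i> * m) (circlepath c r) \<longleftrightarrow>
      ((\<lambda>t. 2 * of_real pi * \<i> * \<phi> (circlepath c r t)) has_integral 2 * of_real pi * \<i> * m) {0..1}"
    by (simp only: has_contour_integral)
  also have "\<dots> \<longleftrightarrow> ((\<lambda>t. \<phi> (circlepath c r t)) has_integral m) {0..1}"
    by (subst has_integral_mult_right_iff) simp_all
  finally show ?thesis .
qed

lemma norm_circlepath: "0 < r \<Longrightarrow> norm (circlepath c r t - c) = r"
  by (simp add: circlepath norm_mult)

context disc_bounded
begin

text \<open>The factor \<open>z - c\<close> turns the contour integral that defines \<open>f(F)\<close> into a circle mean.\<close>

definition resolvent_form :: "complex ^ 'n \<Rightarrow> complex ^ 'n \<Rightarrow> complex \<Rightarrow> complex" where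
  "resolvent_form x y z = (z - c) * herm_inner (resolvent F z *v x) y"

lemma mean_resolvent_form:
  assumes "f holomorphic_on ball c R" "\<rho> < r" "r < R"
  shows "((\<lambda>t. f (circlepath c r t) * resolvent_form x y (circlepath c r t)) has_integral
            herm_inner (fc_integral f F (circlepath c r) *v x) y) {0..1}"
proof -
  have r: "0 < r"
    using rho_nonneg assms by linarith
  have "((\<lambda>z. f z * herm_inner (resolvent F z *v x) y) has_contour_integral
            2 * of_real pi * \<i> * herm_inner (fc_integral f F (circlepath c r) *v x) y) (circlepath c r)"
  proof (rule fc_integral_form[OF _ assms(1)])
    show "path_image (circlepath c r) \<subseteq> ball c R - mat_spectrum F"
      using r not_in_spectrum assms by (auto simp: dist_norm norm_minus_commute)
  qed (simp_all add: finite_mat_spectrum)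
  then have "((\<lambda>z. f z * resolvent_form x y z / (z - c)) has_contour_integral
            2 * of_real pi * \<i> * herm_inner (fc_integral f F (circlepath c r) *v x) y) (circlepath c r)"
    by (rule has_contour_integral_eq) (use r in \<open>auto simp: resolvent_form_def\<close>)
  then show ?thesis
    by (simp add: has_contour_integral_circlepath_iff_mean[OF r])
qed

text \<open>On the circle, \<open>1 / (z - c)\<close> equals \<open>cnj ((z - c) / r\<^sup>2)\<close>. With \<open>K s = \<langle>(1 - s (F - c))\<^sup>-\<^sup>1 x, y\<rangle>\<close> the
  resolvent form is \<open>K (1 / (z - c))\<close>, so its conjugate agrees on the circle with the function
  \<open>z \<mapsto> cnj (K (cnj ((z - c) / r\<^sup>2)))\<close>. This one is holomorphic on the whole closed disc, because
  \<open>\<parallel>F - c\<parallel> < r\<close> keeps the matrix in \<open>K\<close> invertible. Its value at \<open>c\<close> is \<open>cnj \<langle>x, y\<rangle>\<close>, and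
  the mean value property gives the claim.\<close>

lemma mean_cnj_resolvent_form:
  assumes f: "f holomorphic_on ball c R" and r: "\<rho> < r" "r < R"
  shows "((\<lambda>t. f (circlepath c r t) * cnj (resolvent_form x y (circlepath c r t))) has_integral
            f c * cnj (herm_inner x y)) {0..1}"
proof -
  have r0: "0 < r"
    using rho_nonneg assms by linarith
  define A where "A s = mat 1 - (\<chi> i j. (s :: complex) * (F - mat c) $ i $ j)" for s
  define S :: "complex set" where "S = {s. norm s * \<rho> < 1}"
  have A_mult: "A s *v x = x - s *s (F *v x - c *s x)" for s :: complex and x
  proof -
    have "(\<chi> i j. s * (F - mat c) $ i $ j) *v x = s *s ((F - mat c) *v x)"
      by (simp add: matrix_vector_mult_def vec_eq_iff sum_distrib_left mult.assoc)
    then show ?thesis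
      by (simp add: A_def matrix_vector_mult_diff_rdistrib mat_mult_vec)
  qed
  have A_inv: "invertible (A s)" if "s \<in> S" for s
    unfolding invertible_iff_injective
  proof (intro allI impI)
    fix v assume "A s *v v = 0"
    then have "norm v = norm s * norm (F *v v - c *s v)"
      by (simp add: A_mult flip: norm_smult_complex_vec)
    also have "\<dots> \<le> norm s * (\<rho> * norm v)"
      by (intro mult_left_mono bound) auto
    finally have "(1 - norm s * \<rho>) * norm v \<le> 0"
      by (simp add: algebra_simps)
    with that show "v = 0"
      by (simp add: S_def mult_le_0_iff)
  qed
  define K where "K s = herm_inner (matrix_inv (A s) *v x) y" for s
  have K_eq: "K s = herm_inner v y" if "s \<in> S" "A s *v v = x" for s v
    unfolding K_def using that(2) mult_matrix_inv(2)[OF A_inv[OF that(1)]]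
    by (metis matrix_vector_mul_assoc matrix_vector_mul_lid)
  have K_holo: "K holomorphic_on S"
    unfolding K_def
  proof (intro holomorphic_on_herm_inner_matrix holomorphic_on_matrix_inv A_inv)
    show "(\<lambda>s. A s $ i $ j) holomorphic_on S" for i j
      by (auto simp: A_def intro!: holomorphic_intros)
  qed
  define H where "H z = cnj (K (cnj ((z - c) / r\<^sup>2)))" for z
  define T where "T = (\<lambda>z. cnj ((z - c) / r\<^sup>2)) -` S"
  have "open S"
    unfolding S_def by (intro open_Collect_less continuous_intros)
  have K2: "cnj \<circ> K \<circ> cnj holomorphic_on (cnj ` S)"
    using \<open>open S\<close> K_holo
    by (intro holomorphic_on_compose_cnj_cnj) (auto simp: image_image image_cnj_conv_vimage_cnj intro!: open_vimage continuous_intros)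
  have H_holo: "H holomorphic_on T"
  proof -
    have "(cnj \<circ> K \<circ> cnj) \<circ> (\<lambda>z. (z - c) / r\<^sup>2) holomorphic_on T"
    proof (rule holomorphic_on_compose_gen[OF _ K2])
      show "(\<lambda>z. (z - c) / r\<^sup>2) ` T \<subseteq> cnj ` S"
        by (auto simp: T_def image_cnj_conv_vimage_cnj)
    qed (use r0 in \<open>auto intro!: holomorphic_intros\<close>)
    then show ?thesis
      by (simp add: H_def[abs_def] o_def)
  qed
  have cball_T: "cball c r \<subseteq> T"
  proof
    fix z assume "z \<in> cball c r"
    then have "norm (z - c) * \<rho> \<le> r * \<rho>"
      using rho_nonneg by (intro mult_right_mono) (auto simp: dist_norm norm_minus_commute)
    also have "\<dots> < r\<^sup>2"
      using r r0 by (simp add: power2_eq_square)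
    finally show "z \<in> T"
      using r0 by (simp add: T_def S_def norm_divide norm_power flip: complex_cnj_diff)
  qed
  have cball_R: "cball c r \<subseteq> ball c R"
    using r by auto
  have holo: "(\<lambda>z. f z * H z) holomorphic_on cball c r"
    by (intro holomorphic_intros holomorphic_on_subset[OF f cball_R]
        holomorphic_on_subset[OF H_holo cball_T])
  \<comment> \<open>Mean value property, as Cauchy's formula at the centre.\<close>
  have "((\<lambda>z. f z * H z / (z - c)) has_contour_integral 2 * of_real pi * \<i> * (f c * H c)) (circlepath c r)"
    using r0 by (intro Cauchy_integral_circlepath holomorphic_on_imp_continuous_on holo
        holomorphic_on_subset[OF holo]) auto
  then have "((\<lambda>t. f (circlepath c r t) * H (circlepath c r t)) has_integral f c * H c) {0..1}"
    by (simp add: has_contour_integral_circlepath_iff_mean[OF r0])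
  moreover have "H c = cnj (herm_inner x y)"
  proof -
    have "K 0 = herm_inner x y"
      by (rule K_eq) (simp_all add: S_def A_mult)
    then show ?thesis
      by (simp add: H_def)
  qed
  \<comment> \<open>\<open>(1 - s (F - c))\<^sup>-\<^sup>1 = (z - c) (z - F)\<^sup>-\<^sup>1\<close> for \<open>s = 1 / (z - c)\<close>.\<close>
  moreover have "H z = cnj (resolvent_form x y z)" if z: "norm (z - c) = r" for z
  proof -
    define s where "s = 1 / (z - c)"
    have "s \<in> S"
      using z r r0 by (simp add: s_def S_def norm_divide)
    have s: "cnj ((z - c) / r\<^sup>2) = s"
      using z r0 complex_norm_square[of "z - c"] by (auto simp: s_def field_simps)
    have sz: "s * (z - c) = 1"
      using z r0 by (auto simp: s_def)
    define u where "u = resolvent F z *v x"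
    have "z *s u - F *v u = x"
      unfolding u_def using r z by (intro matrix_mult_resolvent not_in_spectrum) auto
    then have Gu: "F *v u - c *s u = (z - c) *s u - x"
      by (simp add: vector_sub_rdistrib algebra_simps)
    have "F *v ((z - c) *s u) - c *s ((z - c) *s u) = (z - c) *s (F *v u - c *s u)"
      by (simp add: vector_scalar_commute vector_ssub_ldistrib vector_smult_assoc mult.commute
          del: vector_sub_rdistrib)
    then have "A s *v ((z - c) *s u) = (z - c) *s u - (s * (z - c)) *s ((z - c) *s u - x)"
      by (simp only: A_mult Gu vector_smult_assoc)
    then have "A s *v ((z - c) *s u) = x"
      by (simp only: sz) simp
    from K_eq[OF \<open>s \<in> S\<close> this] have "K s = resolvent_form x y z"
      by (simp add: resolvent_form_def herm_inner_smult_left u_def del: vector_sub_rdistrib)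
    then show ?thesis
      unfolding H_def s by simp
  qed
  ultimately show ?thesis
    by (simp add: norm_circlepath[OF r0])
qed

section \<open>The Poisson kernel of a matrix and von Neumann's inequality\<close>

text \<open>The sesquilinear form of the Hermitian matrix \<open>P(z) = (z - c) (z - F)\<^sup>-\<^sup>1 + ((z - c) (z - F)\<^sup>-\<^sup>1)\<^sup>* - 1\<close>,
  which for a scalar \<open>F\<close> is the Poisson kernel of the disc.\<close>

definition poisson_form :: "complex ^ 'n \<Rightarrow> complex ^ 'n \<Rightarrow> complex \<Rightarrow> complex" where
  "poisson_form x y z = resolvent_form x y z + cnj (resolvent_form y x z) - herm_inner x y"

lemma cnj_poisson_form: "cnj (poisson_form x y z) = poisson_form y x z"
  by (simp add: poisson_form_def cnj_herm_inner)

lemma poisson_form_self: "poisson_form x x z = of_real (Re (poisson_form x x z))"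
  using cnj_poisson_form[of x x z] by (auto simp: complex_eq_iff)

text \<open>The second summand of the Poisson form contributes \<open>f(c) \<langle>x, y\<rangle>\<close>, which the third one cancels.\<close>

lemma mean_poisson_form:
  assumes "f holomorphic_on ball c R" "\<rho> < r" "r < R"
  shows "((\<lambda>t. f (circlepath c r t) * poisson_form x y (circlepath c r t)) has_integral
            herm_inner (fc_integral f F (circlepath c r) *v x) y) {0..1}"
proof -
  have r: "0 < r"
    using rho_nonneg assms by linarith
  have sub: "cball c r \<subseteq> ball c R" "ball c r \<subseteq> ball c R"
    using assms by auto
  have "((\<lambda>z. f z / (z - c)) has_contour_integral 2 * of_real pi * \<i> * f c) (circlepath c r)"
    using r sub by (intro Cauchy_integral_circlepath holomorphic_on_imp_continuous_on
        holomorphic_on_subset[OF assms(1)]) auto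
  then have "((\<lambda>t. f (circlepath c r t)) has_integral f c) {0..1}"
    by (simp add: has_contour_integral_circlepath_iff_mean[OF r])
  then have "((\<lambda>t. f (circlepath c r t) * herm_inner x y) has_integral f c * herm_inner x y) {0..1}"
    by (rule has_integral_mult_left)
  from has_integral_diff[OF has_integral_add[OF mean_resolvent_form[OF assms, of x y]
        mean_cnj_resolvent_form[OF assms, of y x]] this]
  show ?thesis
    by (simp add: poisson_form_def cnj_herm_inner algebra_simps)
qed

text \<open>For \<open>f = 1\<close> the mean of the resolvent form and the conjugate of the mean of its conjugate are the same
  number; the former is \<open>\<langle>1(F) x, y\<rangle>\<close> and the latter is \<open>\<langle>x, y\<rangle>\<close>.\<close>

lemma fc_integral_one:
  assumes "\<rho> < r"
  shows "fc_integral (\<lambda>_. 1) F (circlepath c r) = mat 1"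
proof (rule herm_inner_matrix_eqI)
  fix x y
  obtain R where R: "r < R"
    using gt_ex by blast
  have "((\<lambda>t. resolvent_form x y (circlepath c r t)) has_integral
          herm_inner (fc_integral (\<lambda>_. 1) F (circlepath c r) *v x) y) {0..1}"
    using mean_resolvent_form[of "\<lambda>_. 1" R r x y] assms R by simp
  moreover have "((\<lambda>t. cnj (cnj (resolvent_form x y (circlepath c r t)))) has_integral
          cnj (cnj (herm_inner x y))) {0..1}"
    using mean_cnj_resolvent_form[of "\<lambda>_. 1" R r x y] assms R
    by (subst has_integral_cnj[unfolded o_def]) simp
  ultimately show "herm_inner (fc_integral (\<lambda>_. 1) F (circlepath c r) *v x) y = herm_inner (mat 1 *v x) y"
    using has_integral_unique by auto
qed

text \<open>With \<open>u = (z - F)\<^sup>-\<^sup>1 x\<close> one has \<open>x = (z - c) u - (F - c) u\<close>, and polarisation yields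
  \<open>\<langle>P(z) x, x\<rangle> = \<parallel>(z - c) u\<parallel>\<^sup>2 - \<parallel>(F - c) u\<parallel>\<^sup>2\<close>. This is where \<open>\<parallel>F - c\<parallel> \<le> r\<close> enters.\<close>

lemma poisson_form_nonneg:
  assumes "\<rho> < r" "norm (z - c) = r"
  shows "0 \<le> Re (poisson_form x x z)"
proof -
  define u where "u = resolvent F z *v x"
  define h where "h = herm_inner ((z - c) *s u) x"
  have u: "z *s u - F *v u = x"
    unfolding u_def using assms by (intro matrix_mult_resolvent not_in_spectrum) auto
  have "norm (F *v u - c *s u) \<le> r * norm u"
    using bound[of u] assms by (meson less_imp_le mult_right_mono norm_ge_zero order_trans)
  then have "(norm (F *v u - c *s u))\<^sup>2 \<le> (norm ((z - c) *s u))\<^sup>2"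
    unfolding norm_smult_complex_vec assms by (intro power_mono) auto
  also have "F *v u - c *s u = (z - c) *s u - x"
    using u by (simp add: vector_sub_rdistrib algebra_simps)
  also have "(norm ((z - c) *s u - x))\<^sup>2
      = (norm ((z - c) *s u))\<^sup>2 - 2 * Re (herm_inner ((z - c) *s u) x) + (norm x)\<^sup>2"
    unfolding Re_herm_inner by (simp add: power2_norm_eq_inner inner_diff inner_commute)
  finally have "(norm x)\<^sup>2 \<le> 2 * Re h"
    by (simp add: h_def)
  moreover have "poisson_form x x z = h + cnj h - herm_inner x x"
    by (simp only: poisson_form_def resolvent_form_def herm_inner_smult_left u_def h_def)
  ultimately show ?thesis
    by simp
qed

lemma mean_poisson_form_self:
  assumes "\<rho> < r"
  shows "((\<lambda>t. Re (poisson_form x x (circlepath c r t))) has_integral (norm x)\<^sup>2) {0..1}"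
proof -
  obtain R where R: "r < R"
    using gt_ex by blast
  show ?thesis
    using has_integral_Re[OF mean_poisson_form[of "\<lambda>_. 1" R r x x]] assms R
    by (simp add: fc_integral_one)
qed

text \<open>\<open>\<langle>f(F) x, x\<rangle>\<close> is the mean of \<open>f\<close> against the nonnegative weight \<open>\<langle>P(z) x, x\<rangle>\<close> of total mass \<open>\<parallel>x\<parallel>\<^sup>2\<close>.
  Hence every half plane that contains the values of \<open>f\<close> on the circle contains the numerical range of
  \<open>f(F)\<close>.\<close>

lemma fc_integral_half_plane:
  assumes f: "f holomorphic_on ball c R" and r: "\<rho> < r" "r < R"
    and half_plane: "\<And>z. norm (z - c) = r \<Longrightarrow> m \<le> Re (a * f z)"
  shows "m * (norm x)\<^sup>2 \<le> Re (a * herm_inner (fc_integral f F (circlepath c r) *v x) x)"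
proof -
  have r0: "0 < r"
    using rho_nonneg r by linarith
  let ?z = "circlepath c r"
  have "((\<lambda>t. Re (a * (f (?z t) * poisson_form x x (?z t)))) has_integral
      Re (a * herm_inner (fc_integral f F ?z *v x) x)) {0..1}"
    by (intro has_integral_Re has_integral_mult_right mean_poisson_form[OF f r])
  moreover have "((\<lambda>t. m * Re (poisson_form x x (?z t))) has_integral m * (norm x)\<^sup>2) {0..1}"
    by (intro has_integral_mult_right mean_poisson_form_self r)
  moreover have "m * Re (poisson_form x x (?z t)) \<le> Re (a * (f (?z t) * poisson_form x x (?z t)))" for t
  proof -
    have z: "norm (?z t - c) = r"
      by (rule norm_circlepath[OF r0])
    have "m * Re (poisson_form x x (?z t)) \<le> Re (a * f (?z t)) * Re (poisson_form x x (?z t))"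
      by (intro mult_right_mono half_plane poisson_form_nonneg[OF r(1)] z)
    also have "\<dots> = Re (a * f (?z t) * of_real (Re (poisson_form x x (?z t))))"
      by simp
    finally show ?thesis
      by (simp add: mult.assoc flip: poisson_form_self)
  qed
  ultimately show ?thesis
    using has_integral_le by blast
qed

text \<open>Von Neumann's inequality. Instead of a Cauchy--Schwarz estimate under the integral, integrate the
  inequality \<open>\<langle>P(z) v, v\<rangle> \<ge> 0\<close> for the vectors \<open>v = f(z) x - y\<close>. This gives
  \<open>0 \<le> m\<^sup>2 \<parallel>x\<parallel>\<^sup>2 + \<parallel>y\<parallel>\<^sup>2 - 2 Re \<langle>f(F) x, y\<rangle>\<close>, and the choice \<open>y = f(F) x\<close> finishes the proof.\<close>

lemma fc_integral_norm_le:
  assumes f: "f holomorphic_on ball c R" and r: "\<rho> < r" "r < R"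
    and norm_le: "\<And>z. norm (z - c) = r \<Longrightarrow> norm (f z) \<le> m"
  shows "norm (fc_integral f F (circlepath c r) *v x) \<le> m * norm x"
proof -
  have r0: "0 < r"
    using rho_nonneg r by linarith
  let ?z = "circlepath c r"
  define y where "y = fc_integral f F ?z *v x"
  have m0: "0 \<le> m"
    using norm_le[OF norm_circlepath[OF r0, of c 0]] norm_ge_zero order_trans by blast
  let ?g = "\<lambda>t. m\<^sup>2 * Re (poisson_form x x (?z t)) + Re (poisson_form y y (?z t))
                 - 2 * Re (f (?z t) * poisson_form x y (?z t))"
  have "(?g has_integral m\<^sup>2 * (norm x)\<^sup>2 + (norm y)\<^sup>2 - 2 * Re (herm_inner y y)) {0..1}"
    unfolding y_def
    by (intro has_integral_diff has_integral_add has_integral_mult_right has_integral_Re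
        mean_poisson_form[OF f r] mean_poisson_form_self r)
  moreover have "0 \<le> ?g t" for t
  proof -
    define z where "z = ?z t"
    have z: "norm (z - c) = r"
      unfolding z_def by (rule norm_circlepath[OF r0])
    define \<alpha> where "\<alpha> = f z"
    have "poisson_form (\<alpha> *s x - y) (\<alpha> *s x - y) z
        = \<alpha> * cnj \<alpha> * poisson_form x x z + poisson_form y y z
            - (\<alpha> * poisson_form x y z + cnj \<alpha> * poisson_form y x z)"
      by (simp add: poisson_form_def resolvent_form_def herm_inner_diff_left herm_inner_diff_right
          herm_inner_smult_left herm_inner_smult_right matrix_vector_mult_diff_distrib
          vector_scalar_commute algebra_simps)
    also have "\<alpha> * poisson_form x y z + cnj \<alpha> * poisson_form y x z = of_real (2 * Re (\<alpha> * poisson_form x y z))"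
      by (simp add: complex_add_cnj flip: cnj_poisson_form[of x y z] complex_cnj_mult)
    also have "\<alpha> * cnj \<alpha> * poisson_form x x z = of_real ((norm \<alpha>)\<^sup>2 * Re (poisson_form x x z))"
      by (metis complex_norm_square of_real_mult poisson_form_self)
    finally have "Re (poisson_form (\<alpha> *s x - y) (\<alpha> *s x - y) z)
       = (norm \<alpha>)\<^sup>2 * Re (poisson_form x x z) + Re (poisson_form y y z) - 2 * Re (\<alpha> * poisson_form x y z)"
      by simp
    moreover have "(norm \<alpha>)\<^sup>2 * Re (poisson_form x x z) \<le> m\<^sup>2 * Re (poisson_form x x z)"
      unfolding \<alpha>_def by (intro mult_right_mono power_mono norm_le z poisson_form_nonneg[OF r(1)]) auto
    ultimately show ?thesis
      using poisson_form_nonneg[OF r(1) z, of "\<alpha> *s x - y"] by (simp add: z_def \<alpha>_def)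
  qed
  ultimately have "0 \<le> m\<^sup>2 * (norm x)\<^sup>2 + (norm y)\<^sup>2 - 2 * Re (herm_inner y y)"
    using has_integral_nonneg by blast
  then have "(norm y)\<^sup>2 \<le> (m * norm x)\<^sup>2"
    by (simp add: power_mult_distrib)
  then show ?thesis
    unfolding y_def using m0 by (simp add: abs_le_square_iff[symmetric])
qed

section \<open>Multiplicativity\<close>

text \<open>Both factors are contour integrals over circles, the second one larger. With \<open>R(z)\<close> for the
  resolvent, the resolvent identity is \<open>R(z) R(w) = (R(z) - R(w)) / (w - z)\<close>, and the double integral splits into two parts. In the part with
  \<open>R(w)\<close> the integral of \<open>f(z) / (w - z)\<close> over the inner circle vanishes, since \<open>w\<close> lies outside it. In the
  part with \<open>R(z)\<close> the order of integration is exchanged, and Cauchy's formula over the outer circle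
  reproduces \<open>g(z)\<close>.\<close>

lemma fc_integral_mult:
  assumes f: "f holomorphic_on ball c R" and g: "g holomorphic_on ball c R"
    and r: "\<rho> < r1" "r1 < r2" "r2 < R"
  shows "fc_integral f F (circlepath c r1) ** fc_integral g F (circlepath c r2)
           = fc_integral (\<lambda>z. f z * g z) F (circlepath c r1)"
proof (rule herm_inner_matrix_eqI)
  fix x y
  let ?\<gamma>1 = "circlepath c r1" and ?\<gamma>2 = "circlepath c r2"
  define A where "A = fc_integral f F ?\<gamma>1"
  define h where "h z = herm_inner (resolvent F z *v x) y" for z
  have r0: "0 < r1" "0 < r2"
    using rho_nonneg r by linarith+
  have im: "path_image ?\<gamma>1 \<subseteq> ball c R - mat_spectrum F" "path_image ?\<gamma>2 \<subseteq> ball c R - mat_spectrum F"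
    using r0 r not_in_spectrum by (auto simp: dist_norm norm_minus_commute)
  have form: "((\<lambda>z. k z * herm_inner (resolvent F z *v v) w) has_contour_integral
            2 * of_real pi * \<i> * herm_inner (fc_integral k F \<gamma> *v v) w) \<gamma>"
    if "k holomorphic_on ball c R" "\<gamma> = ?\<gamma>1 \<or> \<gamma> = ?\<gamma>2" for k \<gamma> v w
    using that im finite_mat_spectrum by (intro fc_integral_form[of "ball c R"]) auto
  have sub: "path_image ?\<gamma>1 \<subseteq> ball c r2" "ball c r2 \<subseteq> ball c R" "cball c r2 \<subseteq> ball c R"
    using r r0 by auto
  have neq: "w - z \<noteq> 0" if "w \<in> path_image ?\<gamma>2" "z \<in> path_image ?\<gamma>1" for w z
    using that r r0 by auto
  have A_resolvent: "2 * of_real pi * \<i> * herm_inner (A *v (resolvent F w *v x)) y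
      = contour_integral ?\<gamma>1 (\<lambda>z. f z * h z / (w - z))" if w: "w \<in> path_image ?\<gamma>2" for w
  proof -
    have "((\<lambda>z. f z * herm_inner (resolvent F z *v (resolvent F w *v x)) y) has_contour_integral
        2 * of_real pi * \<i> * herm_inner (A *v (resolvent F w *v x)) y) ?\<gamma>1"
      unfolding A_def by (rule form[OF f]) simp
    moreover have "((\<lambda>z. h w * (f z / (w - z))) has_contour_integral h w * 0) ?\<gamma>1"
    proof (intro has_contour_integral_lmul Cauchy_theorem_convex_simple)
      show "(\<lambda>z. f z / (w - z)) holomorphic_on ball c r2"
        using w r0 by (intro holomorphic_intros holomorphic_on_subset[OF f sub(2)]) auto
    qed (use sub in auto)
    ultimately have "((\<lambda>z. f z * herm_inner (resolvent F z *v (resolvent F w *v x)) y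
        + h w * (f z / (w - z))) has_contour_integral
        2 * of_real pi * \<i> * herm_inner (A *v (resolvent F w *v x)) y + h w * 0) ?\<gamma>1"
      by (rule has_contour_integral_add)
    then have "((\<lambda>z. f z * h z / (w - z)) has_contour_integral
        2 * of_real pi * \<i> * herm_inner (A *v (resolvent F w *v x)) y + h w * 0) ?\<gamma>1"
    proof (rule has_contour_integral_eq)
      fix z assume z: "z \<in> path_image ?\<gamma>1"
      have "h z - h w = (w - z) * herm_inner (resolvent F z *v (resolvent F w *v x)) y"
        using im z w unfolding h_def
        by (subst herm_inner_diff_left[symmetric], subst resolvent_identity)
           (auto simp: herm_inner_smult_left simp del: vector_sub_rdistrib)
      then have "h z = (w - z) * herm_inner (resolvent F z *v (resolvent F w *v x)) y + h w"
        by (simp add: algebra_simps)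
      then show "f z * herm_inner (resolvent F z *v (resolvent F w *v x)) y
        + h w * (f z / (w - z)) = f z * h z / (w - z)"
        using neq[OF w z] by (simp add: add_divide_distrib distrib_left)
    qed
    then show ?thesis
      by (simp add: contour_integral_unique)
  qed
  have cont_f: "continuous_on (path_image ?\<gamma>1) f" and cont_g: "continuous_on (path_image ?\<gamma>2) g"
    using im f g by (auto intro!: holomorphic_on_imp_continuous_on elim!: holomorphic_on_subset)
  have cont_h: "continuous_on (path_image ?\<gamma>1) h"
    unfolding h_def using im
    by (intro holomorphic_on_imp_continuous_on holomorphic_on_herm_inner_matrix
        holomorphic_on_subset[OF holomorphic_on_resolvent]) auto
  have deriv: "continuous_on {0..1} (\<lambda>t. vector_derivative (circlepath c r) (at t))" for r
    unfolding vector_derivative_circlepath by (intro continuous_intros)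

  have "2 * of_real pi * \<i> * (2 * of_real pi * \<i> * herm_inner ((A ** fc_integral g F ?\<gamma>2) *v x) y)
      = 2 * of_real pi * \<i> * (2 * of_real pi * \<i> *
          herm_inner (fc_integral g F ?\<gamma>2 *v x) (conj_transpose A *v y))"
    using herm_inner_conj_transpose[of "conj_transpose A"] by (simp flip: matrix_vector_mul_assoc)
  also have "\<dots> = 2 * of_real pi * \<i> * contour_integral ?\<gamma>2
       (\<lambda>w. g w * herm_inner (resolvent F w *v x) (conj_transpose A *v y))"
    using contour_integral_unique[OF form[OF g, of ?\<gamma>2]] by simp
  also have "\<dots> = contour_integral ?\<gamma>2
       (\<lambda>w. (2 * of_real pi * \<i>) * (g w * herm_inner (resolvent F w *v x) (conj_transpose A *v y)))"
    using form[OF g, of ?\<gamma>2] by (intro contour_integral_lmul[symmetric]) (auto simp: contour_integrable_on_def)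
  also have "\<dots> = contour_integral ?\<gamma>2 (\<lambda>w. contour_integral ?\<gamma>1 (\<lambda>z. g w * (f z * h z / (w - z))))"
  proof (rule contour_integral_eq)
    fix w assume w: "w \<in> path_image ?\<gamma>2"
    have "(\<lambda>z. f z * h z / (w - z)) contour_integrable_on ?\<gamma>1"
      using neq[OF w]
      by (intro contour_integrable_continuous_circlepath continuous_intros cont_f cont_h) auto
    then have "contour_integral ?\<gamma>1 (\<lambda>z. g w * (f z * h z / (w - z)))
       = g w * (2 * of_real pi * \<i> * herm_inner (A *v (resolvent F w *v x)) y)"
      by (simp only: A_resolvent[OF w] contour_integral_lmul)
    then show "(2 * of_real pi * \<i>) * (g w * herm_inner (resolvent F w *v x) (conj_transpose A *v y))
       = contour_integral ?\<gamma>1 (\<lambda>z. g w * (f z * h z / (w - z)))"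
      using herm_inner_conj_transpose[of "conj_transpose A"] by simp
  qed
  also have "\<dots> = contour_integral ?\<gamma>1 (\<lambda>z. contour_integral ?\<gamma>2 (\<lambda>w. g w * (f z * h z / (w - z))))"
  proof (rule contour_integral_swap)
    show "continuous_on (path_image ?\<gamma>2 \<times> path_image ?\<gamma>1) (\<lambda>(w, z). g w * (f z * h z / (w - z)))"
      unfolding split_def using neq
      by (intro continuous_intros continuous_on_compose2[OF cont_f] continuous_on_compose2[OF cont_g]
          continuous_on_compose2[OF cont_h]) auto
  qed (auto simp: deriv)
  also have "\<dots> = contour_integral ?\<gamma>1 (\<lambda>z. (2 * of_real pi * \<i>) * (f z * g z * h z))"
  proof (rule contour_integral_eq)
    fix z assume z: "z \<in> path_image ?\<gamma>1"
    have "((\<lambda>w. g w / (w - z)) has_contour_integral 2 * of_real pi * \<i> * g z) ?\<gamma>2"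
      using z r0 r sub
      by (intro Cauchy_integral_circlepath holomorphic_on_imp_continuous_on
          holomorphic_on_subset[OF g]) (auto simp: dist_norm norm_minus_commute)
    then have "((\<lambda>w. (f z * h z) * (g w / (w - z))) has_contour_integral
        (f z * h z) * (2 * of_real pi * \<i> * g z)) ?\<gamma>2"
      by (rule has_contour_integral_lmul)
    then show "contour_integral ?\<gamma>2 (\<lambda>w. g w * (f z * h z / (w - z))) = (2 * of_real pi * \<i>) * (f z * g z * h z)"
      by (simp add: contour_integral_unique mult_ac)
  qed
  also have "\<dots> = (2 * of_real pi * \<i>) *
        (2 * of_real pi * \<i> * herm_inner (fc_integral (\<lambda>z. f z * g z) F ?\<gamma>1 *v x) y)"
  proof -
    have "((\<lambda>z. f z * g z * h z) has_contour_integral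
        2 * of_real pi * \<i> * herm_inner (fc_integral (\<lambda>z. f z * g z) F ?\<gamma>1 *v x) y) ?\<gamma>1"
      unfolding h_def using f g by (intro form holomorphic_intros) auto
    then show ?thesis
      by (intro contour_integral_unique has_contour_integral_lmul)
  qed
  finally show "herm_inner ((fc_integral f F ?\<gamma>1 ** fc_integral g F ?\<gamma>2) *v x) y
      = herm_inner (fc_integral (\<lambda>z. f z * g z) F ?\<gamma>1 *v x) y"
    by (simp add: A_def)
qed

end

section \<open>Numerical range in the upper half plane\<close>

text \<open>The numerical range is compact, so it keeps a positive distance from the real axis.\<close>

lemma numerical_range_form_pos:
  fixes F :: "complex ^ 'n ^ 'n"
  assumes "numerical_range F \<subseteq> UHP"
  obtains \<delta> where "0 < \<delta>" "\<And>x. \<delta> * (norm x)\<^sup>2 \<le> Im (herm_inner (F *v x) x)"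
proof -
  let ?S = "sphere (0 :: complex ^ 'n) 1"
  have "axis undefined 1 \<in> ?S"
    by simp
  then have "?S \<noteq> {}"
    by blast
  moreover have "continuous_on ?S (\<lambda>x. Im (herm_inner (F *v x) x))"
    unfolding herm_inner_def matrix_vector_mult_def by (intro continuous_intros)
  ultimately obtain x0 where x0: "x0 \<in> ?S"
      "\<And>x. x \<in> ?S \<Longrightarrow> Im (herm_inner (F *v x0) x0) \<le> Im (herm_inner (F *v x) x)"
    using continuous_attains_inf[of ?S] compact_sphere by blast
  define \<delta> where "\<delta> = Im (herm_inner (F *v x0) x0)"
  show ?thesis
  proof
    have "herm_inner (F *v x0) x0 \<in> numerical_range F"
      using x0(1) by (auto simp: numerical_range_def)
    then show "0 < \<delta>"
      using assms by (auto simp: UHP_def \<delta>_def)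
    show "\<delta> * (norm x)\<^sup>2 \<le> Im (herm_inner (F *v x) x)" for x
    proof (cases "x = 0")
      case False
      define n where "n = norm x"
      define u where "u = of_real (inverse n) *s x"
      have n: "n \<noteq> 0" "n = norm x"
        using False by (simp_all add: n_def)
      have x: "x = of_real n *s u"
        using n(1) by (simp add: u_def vector_smult_assoc flip: of_real_mult)
      have "u \<in> ?S"
        using n by (simp add: u_def norm_smult_complex_vec del: of_real_inverse)
      then have "\<delta> * n\<^sup>2 \<le> Im (herm_inner (F *v u) u) * n\<^sup>2"
        unfolding \<delta>_def using x0(2) by (intro mult_right_mono) auto
      also have "\<dots> = Im (herm_inner (F *v x) x)"
        by (simp add: x vector_scalar_commute herm_inner_smult_left
            herm_inner_smult_right power2_eq_square)
      finally show ?thesis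
        by (simp add: n(2))
    qed (simp add: herm_inner_def)
  qed
qed

text \<open>\<open>\<parallel>F x - \<i> R x\<parallel>\<^sup>2 = \<parallel>F x\<parallel>\<^sup>2 - 2 R Im \<langle>F x, x\<rangle> + R\<^sup>2 \<parallel>x\<parallel>\<^sup>2\<close>. For large \<open>R\<close> the negative term, which is at most
  \<open>- 2 R \<delta> \<parallel>x\<parallel>\<^sup>2\<close>, outweighs \<open>\<parallel>F x\<parallel>\<^sup>2\<close>.\<close>

lemma numerical_range_UHP_disc_bounded:
  fixes F :: "complex ^ 'n ^ 'n"
  assumes "numerical_range F \<subseteq> UHP"
  obtains R \<rho> where "\<rho> < R" "disc_bounded F (\<i> * of_real R) \<rho>"
proof -
  obtain \<delta> where \<delta>: "0 < \<delta>" "\<And>x. \<delta> * (norm x)\<^sup>2 \<le> Im (herm_inner (F *v x) x)"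
    using numerical_range_form_pos[OF assms] by blast
  define M where "M = onorm ((*v) F)"
  have M: "norm (F *v x) \<le> M * norm x" for x
    unfolding M_def by (intro onorm) simp
  \<comment> \<open>The first summand makes \<open>M\<^sup>2 \<le> R \<delta>\<close>; the second one makes the radicand of \<open>\<rho>\<close> nonnegative.\<close>
  define R where "R = M\<^sup>2 / \<delta> + \<delta>"
  define \<rho> where "\<rho> = sqrt (R * (R - \<delta>))"
  have R: "0 < R" "\<delta> \<le> R" "M\<^sup>2 \<le> R * \<delta>"
    using \<delta>(1) by (simp_all add: R_def add_nonneg_pos distrib_right)
  have "\<rho> < sqrt (R\<^sup>2)"
    using R \<delta>(1) unfolding \<rho>_def by (intro real_sqrt_less_mono) (simp add: power2_eq_square)
  then have "\<rho> < R"
    using R by simp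
  moreover have "disc_bounded F (\<i> * of_real R) \<rho>"
  proof
    fix x :: "complex ^ 'n"
    define y where "y = (\<i> * of_real R) *s x"
    have inner: "(F *v x) \<bullet> y = R * Im (herm_inner (F *v x) x)"
      unfolding y_def by (simp add: herm_inner_smult_right flip: Re_herm_inner)
    have "(norm (F *v x - y))\<^sup>2 = (norm (F *v x))\<^sup>2 - 2 * ((F *v x) \<bullet> y) + (norm y)\<^sup>2"
      by (simp add: power2_norm_eq_inner inner_diff inner_commute)
    also have "\<dots> \<le> (M * norm x)\<^sup>2 - 2 * (R * (\<delta> * (norm x)\<^sup>2)) + (R * norm x)\<^sup>2"
    proof -
      have "(norm (F *v x))\<^sup>2 \<le> (M * norm x)\<^sup>2"
        using M[of x] by (intro power_mono) auto
      moreover have "R * (\<delta> * (norm x)\<^sup>2) \<le> (F *v x) \<bullet> y"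
        unfolding inner using R(1) \<delta>(2) by (intro mult_left_mono) auto
      moreover have "norm y = R * norm x"
        using R(1) by (simp add: y_def norm_smult_complex_vec norm_mult)
      ultimately show ?thesis
        by simp
    qed
    also have "\<dots> = (M\<^sup>2 - 2 * (R * \<delta>) + R\<^sup>2) * (norm x)\<^sup>2"
      by (simp add: algebra_simps power_mult_distrib)
    also have "\<dots> \<le> (R * (R - \<delta>)) * (norm x)\<^sup>2"
      using R by (intro mult_right_mono) (auto simp: algebra_simps power2_eq_square)
    also have "\<dots> = (\<rho> * norm x)\<^sup>2"
      using R by (simp add: \<rho>_def power_mult_distrib)
    finally have "norm (F *v x - y) \<le> \<rho> * norm x"
      by (rule power2_le_imp_le) (use R in \<open>simp add: \<rho>_def\<close>)
    then show "norm (F *v x - (\<i> * of_real R) *s x) \<le> \<rho> * norm x"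
      unfolding y_def .
  qed
  ultimately show ?thesis
    using that by blast
qed

section \<open>Contractions and the matrix \<open>1 - A A\<^sup>*\<close>\<close>

lemma norm_conj_transpose_le:
  fixes A :: "complex ^ 'a ^ 'b"
  assumes "\<And>x. norm (A *v x) \<le> m * norm x"
  shows "norm (conj_transpose A *v x) \<le> m * norm x"
proof -
  define y where "y = conj_transpose A *v x"
  have "(norm y)\<^sup>2 = x \<bullet> (A *v y)"
    using herm_inner_conj_transpose[of A x y] by (simp flip: y_def Re_herm_inner Re_herm_inner_self)
  also have "\<dots> \<le> norm x * (m * norm y)"
    using norm_cauchy_schwarz[of x "A *v y"] assms[of y]
    by (meson mult_left_mono norm_ge_zero order_trans)
  finally have "norm y * norm y \<le> (m * norm x) * norm y"
    by (simp add: power2_eq_square algebra_simps)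
  moreover have "0 \<le> m"
  proof -
    have "0 \<le> m * norm (axis undefined 1 :: complex ^ 'a)"
      using assms norm_ge_zero order_trans by blast
    then show ?thesis
      by simp
  qed
  ultimately show ?thesis
    unfolding y_def[symmetric] by (cases "norm y = 0") auto
qed

lemma pos_definite_one_minus_iff:
  "pos_definite (s *\<^sub>R (mat 1 - A ** conj_transpose A)) \<longleftrightarrow>
     (\<forall>x. x \<noteq> 0 \<longrightarrow> 0 < s * ((norm x)\<^sup>2 - (norm (conj_transpose A *v x))\<^sup>2))"
proof -
  have "conj_transpose (s *\<^sub>R (mat 1 - A ** conj_transpose A)) = s *\<^sub>R (mat 1 - A ** conj_transpose A)"
    by (simp add: conj_transpose_def mat_def matrix_matrix_mult_def vec_eq_iff mult.commute)
  moreover have "Re (herm_inner ((s *\<^sub>R (mat 1 - A ** conj_transpose A)) *v x) x)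
      = s * ((norm x)\<^sup>2 - (norm (conj_transpose A *v x))\<^sup>2)" for x
  proof -
    have *: "herm_inner (A *v (conj_transpose A *v x)) x
        = herm_inner (conj_transpose A *v x) (conj_transpose A *v x)"
      using herm_inner_conj_transpose[of "conj_transpose A" "conj_transpose A *v x" x] by simp
    have scaleR: "(s *\<^sub>R B) *v x = s *\<^sub>R (B *v x)" for B :: "complex ^ 'a ^ 'a"
      by (simp add: matrix_vector_mult_def vec_eq_iff scaleR_sum_right)
    have "(mat 1 - A ** conj_transpose A) *v x = x - A *v (conj_transpose A *v x)"
      by (simp add: matrix_vector_mult_diff_rdistrib matrix_vector_mul_assoc)
    then show ?thesis
      by (simp add: scaleR herm_inner_scaleR_left herm_inner_diff_left *)
  qed
  ultimately show ?thesis
    by (simp add: pos_definite_def)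
qed

section \<open>Powers on the upper half plane\<close>

lemma ball_subset_UHP: "ball (\<i> * of_real R) R \<subseteq> UHP"
proof
  fix z assume "z \<in> ball (\<i> * of_real R) R"
  then have "norm (\<i> * of_real R - z) < R"
    by (simp add: dist_norm)
  then have "\<bar>Im (\<i> * of_real R - z)\<bar> < R"
    using abs_Im_le_cmod order_le_less_trans by blast
  then show "z \<in> UHP"
    by (simp add: UHP_def)
qed

lemma Im_Ln_UHP: "z \<in> UHP \<Longrightarrow> 0 < Im (Ln z) \<and> Im (Ln z) < pi"
  using Im_Ln_pos_lt[of z] by (cases "z = 0") (auto simp: UHP_def)

lemma holomorphic_on_powr_UHP: "(\<lambda>z. exp (\<mu> * Ln z)) holomorphic_on UHP"
  by (intro holomorphic_intros) (auto simp: UHP_def complex_nonpos_Reals_iff)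

lemma Im_powr_UHP:
  assumes "z \<in> UHP" "t \<in> {-1..1} - {0}"
  shows "0 < sgn t * Im (exp (of_real t * Ln z))"
proof -
  have "0 < sin (\<bar>t\<bar> * Im (Ln z))"
  proof (rule sin_gt_zero)
    have "\<bar>t\<bar> * Im (Ln z) \<le> 1 * Im (Ln z)"
      using assms Im_Ln_UHP[OF assms(1)] by (intro mult_right_mono) auto
    then show "\<bar>t\<bar> * Im (Ln z) < pi"
      using Im_Ln_UHP[OF assms(1)] by linarith
  qed (use assms Im_Ln_UHP in auto)
  then have "0 < sgn t * sin (t * Im (Ln z))"
    by (cases "0 < t") (auto simp: sgn_real_def abs_real_def split: if_splits)
  then have "0 < exp (t * Re (Ln z)) * (sgn t * sin (t * Im (Ln z)))"
    by simp
  then show ?thesis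
    by (simp add: Im_exp mult.left_commute)
qed

lemma norm_powr_UHP:
  assumes "z \<in> UHP" "0 < t"
  shows "norm (exp (\<i> * of_real t * Ln z)) < 1"
  using Im_Ln_UHP[OF assms(1)] assms(2) by (simp add: mult.assoc)

section \<open>Powers of the matrix\<close>

theorem lemma3p1:
  fixes F :: "complex ^ 'n::finite ^ 'n"
  assumes "numerical_range F \<subseteq> UHP"
  shows "(\<forall>t\<in>{-1..1::real} - {0}.
            numerical_range (mat_powr F (of_real t)) \<subseteq> (\<lambda>z. of_real (sgn t) * z) ` UHP)
       \<and> (\<forall>t::real. t > 0 \<longrightarrow> onorm (\<lambda>x. mat_powr F (\<i> * of_real t) *v x) < 1)
       \<and> (\<forall>t::real. t \<noteq> 0 \<longrightarrow>
            pos_definite (sgn t *\<^sub>R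
              (mat 1 - mat_powr F (\<i> * of_real t) ** conj_transpose (mat_powr F (\<i> * of_real t)))))"
proof -
  obtain R \<rho> where R: "\<rho> < R" and disc: "disc_bounded F (\<i> * of_real R) \<rho>"
    using numerical_range_UHP_disc_bounded[OF assms] by blast
  interpret disc_bounded F "\<i> * of_real R" \<rho>
    by (rule disc)
  let ?c = "\<i> * of_real R" and ?f = "\<lambda>\<mu> z. exp (\<mu> * Ln z)"
  obtain r r' where r: "\<rho> < r" "r < r'" "r' < R"
    using R dense by meson
  have r0: "0 \<le> r"
    using r rho_nonneg by linarith
  have holo: "?f \<mu> holomorphic_on ball ?c R" for \<mu>
    by (rule holomorphic_on_subset[OF holomorphic_on_powr_UHP ball_subset_UHP])
  have powr: "mat_powr F \<mu> = fc_integral (?f \<mu>) F (circlepath ?c s)" if "\<rho> < s" "s < R" for \<mu> s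
    unfolding mat_powr_def
    by (rule holo_calc_eq_fc_integral[OF fc_contour_circlepath[of "ball ?c R"] finite_mat_spectrum])
       (use that holo in auto)
  have circle: "z \<in> UHP" if "norm (z - ?c) = r" for z
    using that r ball_subset_UHP[of R] by (force simp: dist_norm norm_minus_commute)
  have sphere: "sphere ?c r \<noteq> {}" "compact (sphere ?c r)"
    using r0 by auto
  have cont: "continuous_on (sphere ?c r) (?f \<mu>)" for \<mu>
    using r by (intro holomorphic_on_imp_continuous_on holomorphic_on_subset[OF holo]) auto

  have part_i: "numerical_range (mat_powr F (of_real t)) \<subseteq> (\<lambda>z. of_real (sgn t) * z) ` UHP"
    if t: "t \<in> {-1..1} - {0}" for t :: real
  proof
    fix w assume "w \<in> numerical_range (mat_powr F (of_real t))"
    then obtain x where x: "norm x = 1" and w: "w = herm_inner (mat_powr F (of_real t) *v x) x"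
      by (auto simp: numerical_range_def)
    \<comment> \<open>\<open>Re (a w) = sgn t * Im w\<close>, so the half plane lemma covers both signs of \<open>t\<close>.\<close>
    let ?a = "- \<i> * of_real (sgn t)"
    have "continuous_on (sphere ?c r) (\<lambda>z. Re (?a * ?f (of_real t) z))"
      by (intro continuous_intros cont)
    then obtain z0 where z0: "z0 \<in> sphere ?c r"
      "\<And>z. z \<in> sphere ?c r \<Longrightarrow> Re (?a * ?f (of_real t) z0) \<le> Re (?a * ?f (of_real t) z)"
      using continuous_attains_inf[OF sphere(2,1)] by blast
    have "Re (?a * ?f (of_real t) z0) * (norm x)\<^sup>2 \<le> Re (?a * w)"
      unfolding w powr[OF r(1) order.strict_trans[OF r(2,3)]]
      using r z0(2) by (intro fc_integral_half_plane[OF holo]) (auto simp: dist_norm norm_minus_commute)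
    moreover have "0 < Re (?a * ?f (of_real t) z0)"
      using Im_powr_UHP[OF circle t, of z0] z0(1) by (simp add: dist_norm norm_minus_commute)
    ultimately have "0 < Re (?a * w)"
      using x by simp
    then have "of_real (sgn t) * w \<in> UHP"
      by (simp add: UHP_def)
    moreover have "w = of_real (sgn t) * (of_real (sgn t) * w)"
      using t by (simp add: sgn_real_def)
    ultimately show "w \<in> (\<lambda>z. of_real (sgn t) * z) ` UHP"
      by blast
  qed
  have contraction: "\<exists>m<1. \<forall>x. norm (mat_powr F (\<i> * of_real t) *v x) \<le> m * norm x"
    if t: "0 < t" for t :: real
  proof -
    have "continuous_on (sphere ?c r) (\<lambda>z. norm (?f (\<i> * of_real t) z))"
      by (intro continuous_on_norm cont)
    then obtain z0 where z0: "z0 \<in> sphere ?c r"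
      "\<And>z. z \<in> sphere ?c r \<Longrightarrow> norm (?f (\<i> * of_real t) z) \<le> norm (?f (\<i> * of_real t) z0)"
      using continuous_attains_sup[OF sphere(2,1)] by blast
    have "norm (mat_powr F (\<i> * of_real t) *v x) \<le> norm (?f (\<i> * of_real t) z0) * norm x" for x
      unfolding powr[OF r(1) order.strict_trans[OF r(2,3)]]
      using r z0(2) by (intro fc_integral_norm_le[OF holo]) (auto simp: dist_norm norm_minus_commute)
    moreover have "norm (?f (\<i> * of_real t) z0) < 1"
      using z0(1) t by (intro norm_powr_UHP circle) (auto simp: dist_norm norm_minus_commute)
    ultimately show ?thesis
      by blast
  qed
  have part_ii: "onorm (\<lambda>x. mat_powr F (\<i> * of_real t) *v x) < 1" if "0 < t" for t :: real
    using contraction[OF that] by (meson onorm_le order_le_less_trans)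
  have part_iii: "pos_definite (sgn t *\<^sub>R
      (mat 1 - mat_powr F (\<i> * of_real t) ** conj_transpose (mat_powr F (\<i> * of_real t))))"
    if t: "t \<noteq> 0" for t :: real
    unfolding pos_definite_one_minus_iff
  proof (intro allI impI)
    fix x :: "complex ^ 'n" assume x: "x \<noteq> 0"
    let ?A = "mat_powr F (\<i> * of_real t)" and ?B = "mat_powr F (\<i> * of_real (- t))"
    obtain m where m: "m < 1"
      "\<And>x. norm (mat_powr F (\<i> * of_real \<bar>t\<bar>) *v x) \<le> m * norm x"
      using contraction[of "\<bar>t\<bar>"] t by auto
    note adj = norm_conj_transpose_le[OF m(2)]
    show "0 < sgn t * ((norm x)\<^sup>2 - (norm (conj_transpose ?A *v x))\<^sup>2)"
    proof (cases "0 < t")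
      case True
      have "norm (conj_transpose ?A *v x) < norm x"
        using adj[of x] True x m(1) by (auto intro: order_le_less_trans)
      then have "(norm (conj_transpose ?A *v x))\<^sup>2 < (norm x)\<^sup>2"
        by (intro power_strict_mono) auto
      then show ?thesis
        using True by simp
    next
      case False
      \<comment> \<open>Here \<open>B\<close> is the inverse of \<open>A\<close> and a strict contraction, so \<open>A\<^sup>*\<close> is strictly expanding.\<close>
      define y where "y = conj_transpose ?A *v x"
      have "?A ** ?B = fc_integral (\<lambda>z. ?f (\<i> * of_real t) z * ?f (\<i> * of_real (- t)) z) F (circlepath ?c r)"
        unfolding powr[OF r(1) less_trans[OF r(2,3)], of "\<i> * of_real t"]
          powr[OF less_trans[OF r(1,2)] r(3), of "\<i> * of_real (- t)"]
        by (rule fc_integral_mult[OF holo holo r])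
      also have "\<dots> = mat 1"
        by (simp add: fc_integral_one[OF r(1)] flip: exp_add)
      finally have "conj_transpose ?B ** conj_transpose ?A = mat 1"
        by (metis conj_transpose_mult conj_transpose_mat_1)
      then have x_eq: "x = conj_transpose ?B *v y"
        by (simp add: y_def matrix_vector_mul_assoc)
      then have "y \<noteq> 0"
        using x by auto
      have "norm x \<le> m * norm y"
        using adj[of y] False by (subst x_eq) simp
      also have "\<dots> < norm y"
        using m(1) \<open>y \<noteq> 0\<close> by simp
      finally have "norm x < norm y" .
      then have "(norm x)\<^sup>2 < (norm y)\<^sup>2"
        by (intro power_strict_mono) auto
      then show ?thesis
        using False t by (simp add: y_def)
    qed
  qed
  show ?thesis
    by (intro conjI ballI allI impI part_i part_ii part_iii)
qed

end
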